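(* Let $d\ge1$, $1\le p<\infty$, and let $\nu:\mathbb{R}^d\setminus\{0\}\to[0,\infty)$ be measurable. Let $w(r)=(r\,\nu^\#(r))^{1/p}$ be the potential associated with $\nu$ (see context). Assume that $r\mapsto w(r)$ is invertible from $[0,\infty)$ to $[0,\infty)$, that $t\mapsto\phi(t^{1/p})$ is a Young function, where $\phi(t)=1/w^{-1}(1/t)$, and that there is $\theta>0$ such that $\phi(\theta s/t)\le\phi(s)/\phi(t)$ for all $0\le s\le t$, $t>0$. Let $\Omega\subset\mathbb{R}^d$ be a $W^p_\nu$-extension domain. Let $\psi$ be a Young function such that, for some constant $c>0$, $\psi(ct)\le\max(t^p,\phi(t))$ for all $t>0$. Then the embedding $W^p_\nu(\Omega)\hookrightarrow L^\psi(\Omega)$ is continuous. Moreover, if $|\Omega|<\infty$, then the embedding $W^p_\nu(\Omega)\hookrightarrow L^\psi(\Omega)$ is continuous for every Young function $\psi$ such that, for some constant $c>0$, $\psi(ct)\le\max(t,\phi(t))$ for all $t\ge1$.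
   Context: $|E|$ is Lebesgue measure, $c_d=|B(0,1)|$, $\eta(r)=(r/c_d)^{1/d}$. The symmetric decreasing rearrangement of $\nu$ is the radial function $\nu^*(\rho)=\inf\{s>0:|\{\nu>s\}|\le c_d\rho^d\}$, $\rho\ge0$. Define $\nu^\#(r)=\int_{\{\nu<\nu^*(\eta(r))\}}\nu(h)\,dh$, $w(r)=(r\,\nu^\#(r))^{1/p}$ for $r>0$, $w(0)=0$, and $\phi(t)=1/w^{-1}(1/t)$ for $t>0$, $\phi(0)=0$. A Young function is a convex function $\psi:[0,\infty]\to[0,\infty]$ with $\psi(0)=0$, not identically $0$ and not identically $\infty$ on $(0,\infty)$. $L^\psi(\Omega)$ is the Orlicz space of measurable $u:\Omega\to\mathbb{R}$ with $\int_\Omega\psi(|u|/\lambda)\,dx<\infty$ for some $\lambda>0$, with Luxemburg norm $\|u\|_{L^\psi(\Omega)}=\inf\{\lambda>0:\int_\Omega\psi(|u|/\lambda)\,dx\le1\}$. For $\Omega\subset\mathbb{R}^d$ open, $W^p_\nu(\Omega)=\{u\in L^p(\Omega):\int_\Omega\int_\Omega|u(x)-u(y)|^p\nu(x-y)\,dy\,dx<\infty\}$ with norm $\|u\|_{W^p_\nu(\Omega)}=\big(\|u\|^p_{L^p(\Omega)}+\int_\Omega\int_\Omega|u(x)-u(y)|^p\nu(x-y)\,dy\,dx\big)^{1/p}$. An open set $\Omega\subset\mathbb{R}^d$ is a $W^p_\nu$-extension domain if there are a linear operator $E:W^p_\nu(\Omega)\to W^p_\nu(\mathbb{R}^d)$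 and a constant $C=C(\Omega,\nu,d,p)$ such that $Eu|_\Omega=u$ and $\|Eu\|_{W^p_\nu(\mathbb{R}^d)}\le C\|u\|_{W^p_\nu(\Omega)}$ for all $u\in W^p_\nu(\Omega)$. *)

theory Defs
  imports "HOL-Analysis.Analysis"
begin

text \<open>
  Euclidean space \<open>\<real>\<^sup>d\<close> is a type \<open>'a::euclidean_space\<close>, \<open>d = DIM('a)\<close>. Measurability and
  integrals are with respect to Lebesgue (not Borel) measure. A kernel on \<open>\<real>\<^sup>d\<close> without the
  origin is a total function whose value at 0 is never used, and a function on
  \<open>\<Omega>\<close> is a total function whose values off \<open>\<Omega>\<close> are never used.
\<close>

definition epow :: "ennreal \<Rightarrow> real \<Rightarrow> ennreal"
  where "epow x a = (if x = \<infinity> then \<infinity> else ennreal (enn2real x powr a))"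
    \<comment> \<open>only used for \<open>a > 0\<close>\<close>

definition ball_vol :: "'a::euclidean_space itself \<Rightarrow> real"
  where "ball_vol _ = measure lebesgue (ball (0::'a) 1)"

definition eta :: "'a::euclidean_space itself \<Rightarrow> real \<Rightarrow> real"
  where "eta T r = (r / ball_vol T) powr (1 / real DIM('a))"

definition rearr :: "('a::euclidean_space \<Rightarrow> real) \<Rightarrow> real \<Rightarrow> ennreal"
  where "rearr \<nu> \<rho> = Inf {ennreal s | s. s > 0 \<and>
           emeasure lebesgue {h. h \<noteq> 0 \<and> \<nu> h > s} \<le> ennreal (ball_vol TYPE('a) * \<rho> ^ DIM('a))}"

definition nu_sharp :: "('a::euclidean_space \<Rightarrow> real) \<Rightarrow> real \<Rightarrow> ennreal"
  where "nu_sharp \<nu> r =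
           (\<integral>\<^sup>+ h \<in> {h. h \<noteq> 0 \<and> ennreal (\<nu> h) < rearr \<nu> (eta TYPE('a) r)}. ennreal (\<nu> h) \<partial>lebesgue)"

definition w_pot :: "real \<Rightarrow> ('a::euclidean_space \<Rightarrow> real) \<Rightarrow> real \<Rightarrow> ennreal"
  where "w_pot p \<nu> r = (if r = 0 then 0 else epow (ennreal r * nu_sharp \<nu> r) (1 / p))"

text \<open>
  With \<open>1 / 0 = \<infinity>\<close> and \<open>1 / \<infinity> = 0\<close> in \<^typ>\<open>ennreal\<close>, the formula for \<open>\<phi>\<close> also gives
  the value \<open>\<phi> \<infinity> = \<infinity>\<close> when \<open>w\<close> is invertible on \<open>[0,\<infinity>)\<close>.
\<close>

definition phi :: "real \<Rightarrow> ('a::euclidean_space \<Rightarrow> real) \<Rightarrow> ennreal \<Rightarrow> ennreal"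
  where "phi p \<nu> t = (if t = 0 then 0 else 1 / ennreal (the_inv_into {0..} (w_pot p \<nu>) (1 / t)))"

definition young :: "(ennreal \<Rightarrow> ennreal) \<Rightarrow> bool"
  where "young \<psi> \<longleftrightarrow>
           (\<forall>x y. \<forall>l::real. 0 \<le> l \<and> l \<le> 1 \<longrightarrow>
              \<psi> (ennreal l * x + ennreal (1 - l) * y) \<le> ennreal l * \<psi> x + ennreal (1 - l) * \<psi> y) \<and>
           \<psi> 0 = 0 \<and>
           (\<exists>t. 0 < t \<and> t < \<infinity> \<and> \<psi> t \<noteq> 0) \<and>
           (\<exists>t. 0 < t \<and> t < \<infinity> \<and> \<psi> t \<noteq> \<infinity>)"

definition orlicz_modular ::
    "'a::euclidean_space set \<Rightarrow> (ennreal \<Rightarrow> ennreal) \<Rightarrow> ('a \<Rightarrow> real) \<Rightarrow> ennreal"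
  where "orlicz_modular \<Omega> \<psi> u = (\<integral>\<^sup>+ x. \<psi> (ennreal \<bar>u x\<bar>) \<partial>lebesgue_on \<Omega>)"

definition orlicz_space ::
    "'a::euclidean_space set \<Rightarrow> (ennreal \<Rightarrow> ennreal) \<Rightarrow> ('a \<Rightarrow> real) set"
  where "orlicz_space \<Omega> \<psi> =
           {u. u \<in> borel_measurable (lebesgue_on \<Omega>) \<and>
               (\<exists>l>0. orlicz_modular \<Omega> \<psi> (\<lambda>x. u x / l) < \<infinity>)}"

definition luxemburg_norm ::
    "'a::euclidean_space set \<Rightarrow> (ennreal \<Rightarrow> ennreal) \<Rightarrow> ('a \<Rightarrow> real) \<Rightarrow> ennreal"
  where "luxemburg_norm \<Omega> \<psi> u =
           Inf {ennreal l | l. l > 0 \<and> orlicz_modular \<Omega> \<psi> (\<lambda>x. u x / l) \<le> 1}"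

definition Lp_power :: "real \<Rightarrow> 'a::euclidean_space set \<Rightarrow> ('a \<Rightarrow> real) \<Rightarrow> ennreal"
  where "Lp_power p \<Omega> u = (\<integral>\<^sup>+ x. ennreal (\<bar>u x\<bar> powr p) \<partial>lebesgue_on \<Omega>)"

definition W_energy ::
    "real \<Rightarrow> ('a::euclidean_space \<Rightarrow> real) \<Rightarrow> 'a set \<Rightarrow> ('a \<Rightarrow> real) \<Rightarrow> ennreal"
  where "W_energy p \<nu> \<Omega> u =
           (\<integral>\<^sup>+ x. (\<integral>\<^sup>+ y. ennreal (\<bar>u x - u y\<bar> powr p * \<nu> (x - y)) \<partial>lebesgue_on \<Omega>) \<partial>lebesgue_on \<Omega>)"

definition W_space ::
    "real \<Rightarrow> ('a::euclidean_space \<Rightarrow> real) \<Rightarrow> 'a set \<Rightarrow> ('a \<Rightarrow> real) set"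
  where "W_space p \<nu> \<Omega> =
           {u. u \<in> borel_measurable (lebesgue_on \<Omega>) \<and> Lp_power p \<Omega> u < \<infinity> \<and> W_energy p \<nu> \<Omega> u < \<infinity>}"

definition W_norm ::
    "real \<Rightarrow> ('a::euclidean_space \<Rightarrow> real) \<Rightarrow> 'a set \<Rightarrow> ('a \<Rightarrow> real) \<Rightarrow> ennreal"
  where "W_norm p \<nu> \<Omega> u = epow (Lp_power p \<Omega> u + W_energy p \<nu> \<Omega> u) (1 / p)"

text \<open>
  The function spaces consist of functions rather than of classes modulo null sets, so the
  identities required of an extension operator hold almost everywhere. That \<open>E\<close> respects
  almost-everywhere equality on \<open>\<Omega>\<close> follows from its linearity and boundedness.
\<close>

definition extension_domain ::
    "real \<Rightarrow> ('a::euclidean_space \<Rightarrow> real) \<Rightarrow> 'a set \<Rightarrow> bool"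
  where "extension_domain p \<nu> \<Omega> \<longleftrightarrow> open \<Omega> \<and>
           (\<exists>(E :: ('a \<Rightarrow> real) \<Rightarrow> ('a \<Rightarrow> real)) (C :: real).
              (\<forall>u \<in> W_space p \<nu> \<Omega>. E u \<in> W_space p \<nu> UNIV) \<and>
              (\<forall>u \<in> W_space p \<nu> \<Omega>. \<forall>v \<in> W_space p \<nu> \<Omega>. \<forall>a b :: real.
                 AE x in lebesgue. E (\<lambda>z. a * u z + b * v z) x = a * E u x + b * E v x) \<and>
              (\<forall>u \<in> W_space p \<nu> \<Omega>. AE x in lebesgue_on \<Omega>. E u x = u x) \<and>
              (\<forall>u \<in> W_space p \<nu> \<Omega>. W_norm p \<nu> UNIV (E u) \<le> ennreal C * W_norm p \<nu> \<Omega> u))"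

definition W_embeds_Orlicz ::
    "real \<Rightarrow> ('a::euclidean_space \<Rightarrow> real) \<Rightarrow> 'a set \<Rightarrow> (ennreal \<Rightarrow> ennreal) \<Rightarrow> bool"
  where "W_embeds_Orlicz p \<nu> \<Omega> \<psi> \<longleftrightarrow>
           W_space p \<nu> \<Omega> \<subseteq> orlicz_space \<Omega> \<psi> \<and>
           (\<exists>C::real. \<forall>u \<in> W_space p \<nu> \<Omega>. luxemburg_norm \<Omega> \<psi> u \<le> ennreal C * W_norm p \<nu> \<Omega> u)"

end

theory Submission
  imports Defs
begin

text \<open>
  The extension operator reduces everything to a modular bound on the whole space. Rescale so that
  \<open>u\<close> has norm at most 1, and write \<open>a\<^sub>k = |{|u| \<ge> 2\<^sup>k}|\<close>, \<open>T = 2\<^sup>p\<close> and \<open>W(a) = w(a)\<^sup>p = a \<nu>\<^sup>#(a)\<close>. Among all sets of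
  measure \<open>a\<close>, superlevel sets of \<open>\<nu>\<close> leave the least mass of \<open>\<nu>\<close> outside, so integrating the energy
  over pairs of points on opposite sides of the dyadic levels bounds \<open>\<Sum>\<^sub>k T\<^sup>k a\<^sub>k\<^sub>+\<^sub>1 \<nu>\<^sup>#(a\<^sub>k)\<close>.

  The condition on \<open>\<phi>(\<theta> s / t)\<close> together with the convexity of \<open>G(t) = \<phi>(t\<^sup>1\<^sup>/\<^sup>p)\<close> gives, for \<open>a' \<le> a\<close>,
  \<open>W(a') \<le> W(a) / (2 T) + K a' \<nu>\<^sup>#(a)\<close>. With \<open>a = a\<^sub>k\<close> and \<open>a' = a\<^sub>k\<^sub>+\<^sub>1\<close> the first term is absorbed, so that
  \<open>\<Sum>\<^sub>k T\<^sup>k W(a\<^sub>k) \<le> C\<close>. Since \<open>G(1 / W(a)) = 1 / a\<close>, convexity turns this into \<open>\<Sum>\<^sub>k a\<^sub>k G(T\<^sup>k / C) \<le> 1\<close>, which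
  dominates the modular of \<open>u / (2 C\<^sup>1\<^sup>/\<^sup>p)\<close>.
\<close>

section \<open>Mass of the kernel outside a set of given measure: the bathtub principle\<close>

text \<open>For \<open>0 < t < s\<close> the set \<open>E\<close> has at most the measure of
  \<open>{t < f}\<close>. The part of \<open>E\<close> where \<open>f \<le> t\<close> can therefore
  be traded for the part of \<open>{t < f}\<close> outside \<open>E\<close>, where \<open>f\<close>
  is larger. Letting \<open>t\<close> tend to \<open>s\<close> from below gives the claim.\<close>

lemma ennreal_bathtub:
  fixes f :: "'b \<Rightarrow> ennreal"
  assumes f: "f \<in> borel_measurable M" and E: "E \<in> sets M" and fin: "emeasure M E < \<infinity>"
    and level: "\<And>t. 0 < t \<Longrightarrow> t < s \<Longrightarrow> emeasure M E \<le> emeasure M {x \<in> space M. t < f x}"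
  shows "(\<integral>\<^sup>+x\<in>{x. f x < s}. f x \<partial>M) \<le> (\<integral>\<^sup>+x\<in>- E. f x \<partial>M)"
proof -
  have le: "(\<integral>\<^sup>+x\<in>{x. f x \<le> t}. f x \<partial>M) \<le> (\<integral>\<^sup>+x\<in>- E. f x \<partial>M)" if t: "0 < t" "t < s" for t
  proof -
    define L where "L = {x \<in> space M. f x \<le> t}"
    define H where "H = {x \<in> space M. t < f x}"
    have [measurable]: "f \<in> borel_measurable M" "E \<in> sets M" by fact+
    have LM[measurable]: "L \<in> sets M" unfolding L_def by measurable
    have HM[measurable]: "H \<in> sets M" unfolding H_def by measurable
    have Esp: "E \<subseteq> space M" using E by (rule sets.sets_into_space)
    have "emeasure M (E \<inter> H) + emeasure M (E \<inter> L) = emeasure M E"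
      by (subst plus_emeasure) (use Esp in \<open>auto simp: L_def H_def intro!: arg_cong[where f="emeasure M"]\<close>)
    also have "\<dots> \<le> emeasure M H" using level[OF t] by (simp add: H_def)
    also have "\<dots> = emeasure M (E \<inter> H) + emeasure M (H - E)"
      by (subst plus_emeasure) (auto intro!: arg_cong[where f="emeasure M"])
    \<comment> \<open>The common part \<open>E \<inter> H\<close> cancels because \<open>E\<close>
      has finite measure.\<close>
    finally have "emeasure M (E \<inter> L) \<le> emeasure M (H - E)"
      using fin emeasure_mono[of "E \<inter> H" E M] E
      by (subst (asm) ennreal_add_left_cancel_le) (auto simp: top_unique)
    hence m: "t * emeasure M (E \<inter> L) \<le> t * emeasure M (H - E)"
      by (rule mult_left_mono) simp
    have "(\<integral>\<^sup>+x\<in>{x. f x \<le> t}. f x \<partial>M) = (\<integral>\<^sup>+x. f x * indicator (E \<inter> L) x + f x * indicator (L - E) x \<partial>M)"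
      by (intro nn_integral_cong) (auto simp: L_def indicator_def)
    also have "\<dots> = (\<integral>\<^sup>+x. f x * indicator (E \<inter> L) x \<partial>M) + (\<integral>\<^sup>+x. f x * indicator (L - E) x \<partial>M)"
      by (rule nn_integral_add) measurable
    also have "(\<integral>\<^sup>+x. f x * indicator (E \<inter> L) x \<partial>M) \<le> (\<integral>\<^sup>+x. t * indicator (E \<inter> L) x \<partial>M)"
      by (intro nn_integral_mono) (auto simp: L_def indicator_def)
    also have "\<dots> = t * emeasure M (E \<inter> L)" by (rule nn_integral_cmult_indicator) measurable
    also note m
    also have "t * emeasure M (H - E) = (\<integral>\<^sup>+x. t * indicator (H - E) x \<partial>M)"
      by (rule nn_integral_cmult_indicator[symmetric]) measurable
    also have "\<dots> \<le> (\<integral>\<^sup>+x. f x * indicator (H - E) x \<partial>M)"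
      by (intro nn_integral_mono) (auto simp: H_def indicator_def)
    also have "(\<integral>\<^sup>+x. f x * indicator (H - E) x \<partial>M) + (\<integral>\<^sup>+x. f x * indicator (L - E) x \<partial>M)
             = (\<integral>\<^sup>+x. f x * indicator (H - E) x + f x * indicator (L - E) x \<partial>M)"
      by (rule nn_integral_add[symmetric]) measurable
    also have "\<dots> = (\<integral>\<^sup>+x\<in>- E. f x \<partial>M)"
      by (intro nn_integral_cong) (auto simp: L_def H_def indicator_def)
    finally show ?thesis by (simp add: add_right_mono)
  qed
  show ?thesis
  proof (cases "s = 0")
    case True
    then show ?thesis by simp
  next
    case False
    then obtain t where t: "\<And>n::nat. t n < s" "t \<longlonglongrightarrow> s"
      using approx_from_below_dense_linorder[of 0 s] by (auto simp: zero_less_iff_neq_zero)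
    have le0: "(\<integral>\<^sup>+x\<in>{x. f x \<le> t n}. f x \<partial>M) \<le> (\<integral>\<^sup>+x\<in>- E. f x \<partial>M)" for n
    proof (cases "t n = 0")
      case True
      then have "(\<lambda>x. f x * indicator {x. f x \<le> t n} x) = (\<lambda>_. 0)"
        by (auto simp: indicator_def)
      then show ?thesis by simp
    qed (use le t in \<open>auto simp: zero_less_iff_neq_zero\<close>)
    have [measurable]: "f \<in> borel_measurable M" by fact
    \<comment> \<open>The levels \<open>t n\<close> are not known to be monotone, so the limit is
      taken with Fatou's lemma.\<close>
    have "(\<integral>\<^sup>+x\<in>{x. f x < s}. f x \<partial>M) \<le> (\<integral>\<^sup>+x. liminf (\<lambda>n. f x * indicator {x. f x \<le> t n} x) \<partial>M)"
    proof (intro nn_integral_mono)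
      fix x
      show "f x * indicator {x. f x < s} x \<le> liminf (\<lambda>n. f x * indicator {x. f x \<le> t n} x)"
      proof (cases "f x < s")
        case True
        then have "\<forall>\<^sub>F n in sequentially. f x < t n" using order_tendstoD(1)[OF t(2)] by blast
        then have "\<forall>\<^sub>F n in sequentially. f x \<le> f x * indicator {x. f x \<le> t n} x"
          by eventually_elim auto
        then show ?thesis using True by (auto intro!: Liminf_bounded)
      qed simp
    qed
    also have "\<dots> \<le> liminf (\<lambda>n. \<integral>\<^sup>+x. f x * indicator {x. f x \<le> t n} x \<partial>M)"
    proof (rule nn_integral_liminf)
      fix n
      have "(\<lambda>x. f x * indicator {x \<in> space M. f x \<le> t n} x) \<in> borel_measurable M" by measurable
      then show "(\<lambda>x. f x * indicator {x. f x \<le> t n} x) \<in> borel_measurable M"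
        by (rule measurable_cong[THEN iffD1, rotated]) (auto simp: indicator_def)
    qed
    also have "\<dots> \<le> (\<integral>\<^sup>+x\<in>- E. f x \<partial>M)"
      by (rule order_trans[OF Liminf_le_Limsup Limsup_bounded]) (auto intro!: always_eventually le0)
    finally show ?thesis .
  qed
qed

text \<open>\<open>eta\<close> gives the radius of the ball of volume \<open>r\<close>, so at this
  radius the condition under the infimum in \<open>rearr\<close> reads
  \<open>|{\<nu> > s}| \<le> r\<close>.\<close>

lemma eta_volume:
  assumes "0 \<le> r"
  shows "ball_vol TYPE('a::euclidean_space) * eta TYPE('a) r ^ DIM('a) = r"
proof -
  have b: "ball_vol TYPE('a) > 0" by (auto simp: ball_vol_def content_ball_pos)
  show ?thesis
  proof (cases "r = 0")
    case False
    then have "eta TYPE('a) r ^ DIM('a) = r / ball_vol TYPE('a)"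
      using assms b by (simp add: eta_def powr_powr flip: powr_realpow)
    then show ?thesis using b by simp
  qed (simp add: eta_def)
qed

lemma borel_measurable_kernel_off_zero:
  fixes \<nu> :: "'a::euclidean_space \<Rightarrow> real"
  assumes "\<nu> \<in> borel_measurable (lebesgue_on (UNIV - {0}))"
  shows "(\<lambda>h. ennreal (\<nu> h) * indicator (- {0}) h) \<in> borel_measurable lebesgue"
proof -
  have "(\<lambda>h. ennreal (\<nu> h)) \<in> borel_measurable (lebesgue_on (UNIV - {0}))"
    using assms by measurable
  then show ?thesis
    unfolding Compl_eq_Diff_UNIV by (subst (asm) borel_measurable_restrict_space_iff_ennreal) auto
qed

text \<open>Bathtub principle with \<open>s\<close> the rearrangement at radius
  \<open>eta r\<close>: a level \<open>t < s\<close> with \<open>|{\<nu> > t}| \<le> r\<close> would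
  compete in the infimum defining \<open>s\<close>, so every such superlevel set is larger than
  \<open>E\<close>.\<close>

lemma nu_sharp_le_integral_compl:
  fixes \<nu> :: "'a::euclidean_space \<Rightarrow> real"
  assumes \<nu>: "\<nu> \<in> borel_measurable (lebesgue_on (UNIV - {0}))"
    and E: "E \<in> sets lebesgue" and r: "emeasure lebesgue E = ennreal r" "0 \<le> r"
  shows "nu_sharp \<nu> r \<le> (\<integral>\<^sup>+h\<in>- E. ennreal (\<nu> h) * indicator (- {0}) h \<partial>lebesgue)"
proof -
  define f where "f h = ennreal (\<nu> h) * indicator (- {0}) h" for h
  define s where "s = rearr \<nu> (eta TYPE('a) r)"
  have f: "f \<in> borel_measurable lebesgue"
    unfolding f_def by (rule borel_measurable_kernel_off_zero[OF \<nu>])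
  have "nu_sharp \<nu> r = (\<integral>\<^sup>+h\<in>{h. f h < s}. f h \<partial>lebesgue)"
    unfolding nu_sharp_def s_def[symmetric]
    by (intro nn_integral_cong) (auto simp: f_def indicator_def)
  also have "\<dots> \<le> (\<integral>\<^sup>+h\<in>- E. f h \<partial>lebesgue)"
  proof (rule ennreal_bathtub[OF f E])
    show "emeasure lebesgue E < \<infinity>" using r by simp
    fix t assume t: "0 < t" "t < s"
    then obtain t' where t': "t = ennreal t'" "0 < t'"
      by (cases t) auto
    have "\<not> emeasure lebesgue {h. h \<noteq> 0 \<and> \<nu> h > t'} \<le> ennreal r"
    proof
      assume "emeasure lebesgue {h. h \<noteq> 0 \<and> \<nu> h > t'} \<le> ennreal r"
      then have "s \<le> ennreal t'"
        unfolding s_def rearr_def eta_volume[OF r(2)] using t' by (intro Inf_lower) auto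
      with t t' show False by simp
    qed
    moreover have "{h. h \<noteq> 0 \<and> \<nu> h > t'} = {x \<in> space lebesgue. t < f x}"
      using t' by (auto simp: f_def indicator_def ennreal_less_iff)
    ultimately show "emeasure lebesgue E \<le> emeasure lebesgue {x \<in> space lebesgue. t < f x}"
      using r by simp
  qed
  finally show ?thesis by (simp add: f_def)
qed

text \<open>The reflection is the affine map whose diagonal coefficients are all -1, so its Jacobian
  has absolute value 1.\<close>

lemma distr_lebesgue_reflect:
  fixes x :: "'a::euclidean_space"
  shows "(\<lambda>h. x - h) \<in> lebesgue \<rightarrow>\<^sub>M lebesgue"
    and "distr lebesgue lebesgue (\<lambda>h. x - h) = lebesgue"
proof -
  have eq: "(\<lambda>h. x + (\<Sum>j\<in>Basis. (- 1 * (h \<bullet> j)) *\<^sub>R j)) = (\<lambda>h. x - h)"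
    by (simp add: sum_negf euclidean_representation)
  show m: "(\<lambda>h. x - h) \<in> lebesgue \<rightarrow>\<^sub>M lebesgue"
    using lebesgue_affine_measurable[of "\<lambda>_. - 1" x] unfolding eq by simp
  show "distr lebesgue lebesgue (\<lambda>h. x - h) = lebesgue"
    using lebesgue_affine_euclidean[of "\<lambda>_. - 1" x] unfolding eq
    by (simp add: density_1)
qed

text \<open>The substitution \<open>h = x - y\<close> carries \<open>A\<close> to a set of the same
  measure, so one lower bound serves every centre \<open>x\<close>.\<close>

lemma nu_sharp_le_integral_level:
  fixes \<nu> :: "'a::euclidean_space \<Rightarrow> real"
  assumes \<nu>: "\<nu> \<in> borel_measurable (lebesgue_on (UNIV - {0}))"
    and A: "A \<in> sets lebesgue" and r: "emeasure lebesgue A = ennreal r" "0 \<le> r"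
  shows "nu_sharp \<nu> r \<le> (\<integral>\<^sup>+y\<in>- A. ennreal (\<nu> (x - y)) * indicator (- {x}) y \<partial>lebesgue)"
    and "(\<lambda>y. ennreal (\<nu> (x - y)) * indicator (- {x}) y) \<in> borel_measurable lebesgue"
proof -
  let ?R = "\<lambda>h. x - h"
  have R: "?R \<in> lebesgue \<rightarrow>\<^sub>M lebesgue" "distr lebesgue lebesgue ?R = lebesgue"
    by (rule distr_lebesgue_reflect)+
  define E where "E = ?R -` A \<inter> space lebesgue"
  have E: "E \<in> sets lebesgue" unfolding E_def by (rule measurable_sets[OF R(1) A])
  have "emeasure lebesgue E = emeasure lebesgue A"
    unfolding E_def using emeasure_distr[OF R(1) A] R(2) by simp
  then have Er: "emeasure lebesgue E = ennreal r" using r by simp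
  define f where "f h = ennreal (\<nu> h) * indicator (- {0}) h" for h
  have f: "f \<in> borel_measurable lebesgue"
    unfolding f_def by (rule borel_measurable_kernel_off_zero[OF \<nu>])
  have fR: "f (x - y) = ennreal (\<nu> (x - y)) * indicator (- {x}) y" for y
    by (auto simp: f_def indicator_def)
  show "(\<lambda>y. ennreal (\<nu> (x - y)) * indicator (- {x}) y) \<in> borel_measurable lebesgue"
    unfolding fR[symmetric] by (rule measurable_compose[OF R(1) f])
  have "nu_sharp \<nu> r \<le> (\<integral>\<^sup>+h\<in>- E. f h \<partial>lebesgue)"
    unfolding f_def by (rule nu_sharp_le_integral_compl[OF \<nu> E Er r(2)])
  also have "\<dots> = (\<integral>\<^sup>+h\<in>- E. f h \<partial>distr lebesgue lebesgue ?R)" by (simp add: R(2))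
  also have "\<dots> = (\<integral>\<^sup>+y. f (x - y) * indicator (- E) (x - y) \<partial>lebesgue)"
  proof (rule nn_integral_distr[OF R(1)])
    have "- E \<in> sets lebesgue" using sets.compl_sets[OF E] by (simp add: Compl_eq_Diff_UNIV)
    then show "(\<lambda>h. f h * indicator (- E) h) \<in> borel_measurable (distr lebesgue lebesgue ?R)"
      unfolding R(2) using f by (intro borel_measurable_times_ennreal borel_measurable_indicator)
  qed
  also have "\<dots> = (\<integral>\<^sup>+y\<in>- A. ennreal (\<nu> (x - y)) * indicator (- {x}) y \<partial>lebesgue)"
    unfolding fR by (intro nn_integral_cong) (auto simp: E_def indicator_def)
  finally show "nu_sharp \<nu> r \<le> (\<integral>\<^sup>+y\<in>- A. ennreal (\<nu> (x - y)) * indicator (- {x}) y \<partial>lebesgue)" .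
qed

section \<open>Lower bound of the energy by dyadic levels\<close>

text \<open>A geometric sum of ratio \<open>2 powr p\<close>, which is at least 2, is at most twice
  its top term.\<close>

lemma sum_dyadic_powr_le:
  fixes p :: real and F :: "int set" and l :: int
  assumes "1 \<le> p" and "finite F" and "\<And>k. k \<in> F \<Longrightarrow> k \<le> l"
  shows "(\<Sum>k\<in>F. 2 powr (p * k)) \<le> 2 * 2 powr (p * l)"
proof -
  have geo: "(\<Sum>k\<in>{m..l}. 2 powr (p * k)) \<le> 2 * 2 powr (p * l)" if "m \<le> l" for m l :: int
    using that
  proof (induction l rule: int_ge_induct)
    case (step l)
    have "2 \<le> 2 powr p" using powr_mono[of 1 p 2] assms(1) by simp
    then have *: "2 * 2 powr (p * l) \<le> 2 powr p * 2 powr (p * l)" by (intro mult_right_mono) auto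
    have "{m..l + 1} = insert (l + 1) {m..l}" using step by auto
    then have "(\<Sum>k\<in>{m..l + 1}. 2 powr (p * k)) = 2 powr (p * (l + 1)) + (\<Sum>k\<in>{m..l}. 2 powr (p * k))"
      by simp
    moreover have "2 powr (p * (l + 1)) = 2 powr p * 2 powr (p * l)"
      by (simp add: distrib_left powr_add)
    ultimately show ?case using step.IH * by linarith
  qed simp
  show ?thesis
  proof (cases "F = {}")
    case False
    then have "F \<subseteq> {Min F..l}" "Min F \<le> l" using assms by auto
    then show ?thesis
      using order_trans[OF sum_mono2[OF _ \<open>F \<subseteq> _\<close>] geo[OF \<open>Min F \<le> l\<close>]] by auto
  qed simp
qed

text \<open>Only levels that separate \<open>\<bar>b\<bar>\<close> from \<open>\<bar>a\<bar>\<close>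
  contribute. The highest one, \<open>l\<close>, dominates their sum up to a factor 2, which the
  weight 1/2 cancels.\<close>

lemma sum_levels_le_diff_powr:
  fixes p N a b :: real and F :: "int set"
  assumes p: "1 \<le> p" and N: "0 < N" and F: "finite F"
  shows "(\<Sum>k\<in>F. (N powr p / 2 * 2 powr (p * k)) *
            (indicat_real {x. N * 2 powr (k + 1) \<le> x} \<bar>a\<bar> * indicat_real {x. x < N * 2 powr k} \<bar>b\<bar>))
         \<le> \<bar>a - b\<bar> powr p"
proof -
  define G where "G = {k \<in> F. N * 2 powr (k + 1) \<le> \<bar>a\<bar> \<and> \<bar>b\<bar> < N * 2 powr k}"
  have "(\<Sum>k\<in>F. (N powr p / 2 * 2 powr (p * k)) *
            (indicat_real {x. N * 2 powr (k + 1) \<le> x} \<bar>a\<bar> * indicat_real {x. x < N * 2 powr k} \<bar>b\<bar>))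
      = (\<Sum>k\<in>G. N powr p / 2 * 2 powr (p * k))"
    unfolding G_def using F by (intro sum.mono_neutral_cong_right) (auto simp: indicator_def)
  also have "\<dots> = N powr p / 2 * (\<Sum>k\<in>G. 2 powr (p * k))" by (simp add: sum_distrib_left)
  also have "\<dots> \<le> \<bar>a - b\<bar> powr p"
  proof (cases "G = {}")
    case False
    have G: "finite G" using F by (simp add: G_def)
    define l where "l = Max G"
    have "l \<in> G" using G False by (simp add: l_def)
    then have l: "N * 2 powr (l + 1) \<le> \<bar>a\<bar>" "\<bar>b\<bar> < N * 2 powr l" by (auto simp: G_def)
    have "N powr p / 2 * (\<Sum>k\<in>G. 2 powr (p * k)) \<le> N powr p / 2 * (2 * 2 powr (p * l))"
      using sum_dyadic_powr_le[OF p G, of l] G by (intro mult_left_mono) (auto simp: l_def)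
    also have "\<dots> = (N * 2 powr l) powr p"
      using N by (simp add: powr_mult powr_powr mult.commute)
    also have "\<dots> \<le> \<bar>a - b\<bar> powr p"
    proof (rule powr_mono2)
      \<comment> \<open>The two thresholds are one dyadic step apart; this leaves a gap of
        \<open>N * 2 powr l\<close> between \<open>\<bar>a\<bar>\<close> and
        \<open>\<bar>b\<bar>\<close>.\<close>
      have "N * 2 powr (l + 1) = N * 2 powr l * 2" by (simp add: powr_add)
      with l show "N * 2 powr l \<le> \<bar>a - b\<bar>" by linarith
    qed (use p N in auto)
    finally show ?thesis .
  qed simp
  finally show ?thesis .
qed

text \<open>For fixed \<open>x\<close> in \<open>A (k + 1)\<close>, the kernel mass over the
  \<open>y\<close> outside \<open>A k\<close> is at least \<open>nu_sharp \<nu> (a k)\<close>. The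
  weighted sum of these contributions stays below the energy integrand pointwise, and integrating in
  \<open>x\<close> produces the factor \<open>a (k + 1)\<close>.\<close>

lemma W_energy_ge_levels:
  fixes \<nu> :: "'a::euclidean_space \<Rightarrow> real" and u :: "'a \<Rightarrow> real" and a :: "int \<Rightarrow> real"
  assumes p: "1 \<le> p" and N: "0 < N" and F: "finite F"
    and \<nu>: "\<nu> \<in> borel_measurable (lebesgue_on (UNIV - {0}))"
    and \<nu>0: "\<And>h. h \<noteq> 0 \<Longrightarrow> 0 \<le> \<nu> h"
    and u: "u \<in> borel_measurable lebesgue"
    and a: "\<And>k. emeasure lebesgue {x. N * 2 powr k \<le> \<bar>u x\<bar>} = ennreal (a k)" "\<And>k. 0 \<le> a k"
  shows "(\<Sum>k\<in>F. ennreal (N powr p / 2 * 2 powr (p * k)) * (ennreal (a (k + 1)) * nu_sharp \<nu> (a k)))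
         \<le> W_energy p \<nu> UNIV u"
proof -
  define A where "A k = {x. N * 2 powr (k::int) \<le> \<bar>u x\<bar>}" for k
  define c where "c k = ennreal (N powr p / 2 * 2 powr (p * k))" for k :: int
  have A: "A k \<in> sets lebesgue" for k
  proof -
    have "{x \<in> space lebesgue. N * 2 powr (k::int) \<le> \<bar>u x\<bar>} \<in> sets lebesgue" using u by measurable
    then show ?thesis unfolding A_def by (simp only: space_completion space_lborel space_borel UNIV_I simp_thms)
  qed
  have eA: "emeasure lebesgue (A k) = ennreal (a k)" for k unfolding A_def by (rule a(1))
  have nA: "- A k \<in> sets lebesgue" for k
    using sets.compl_sets[OF A[of k]] by (simp add: Compl_eq_Diff_UNIV)
  have inner: "(\<Sum>k\<in>F. c k * (indicator (A (k + 1)) x * nu_sharp \<nu> (a k)))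
       \<le> (\<integral>\<^sup>+y. ennreal (\<bar>u x - u y\<bar> powr p * \<nu> (x - y)) \<partial>lebesgue)" for x
  proof -
    define g where "g y = ennreal (\<nu> (x - y)) * indicator (- {x}) y" for y
    have g: "g \<in> borel_measurable lebesgue"
      unfolding g_def by (rule nu_sharp_le_integral_level(2)[OF \<nu> A eA a(2)])
    have gA [measurable]: "(\<lambda>y. g y * indicator (- A k) y) \<in> borel_measurable lebesgue" for k
      by (intro borel_measurable_times_ennreal g borel_measurable_indicator nA)
    have "(\<Sum>k\<in>F. c k * (indicator (A (k + 1)) x * nu_sharp \<nu> (a k)))
        \<le> (\<Sum>k\<in>F. c k * (indicator (A (k + 1)) x * (\<integral>\<^sup>+y\<in>- A k. g y \<partial>lebesgue)))"
      unfolding g_def by (intro sum_mono mult_left_mono nu_sharp_le_integral_level(1)[OF \<nu> A eA a(2)]) auto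
    also have "\<dots> = (\<integral>\<^sup>+y. (\<Sum>k\<in>F. c k * (indicator (A (k + 1)) x * (g y * indicator (- A k) y))) \<partial>lebesgue)"
      by (simp add: nn_integral_sum nn_integral_cmult gA)
    also have "\<dots> \<le> (\<integral>\<^sup>+y. ennreal (\<bar>u x - u y\<bar> powr p * \<nu> (x - y)) \<partial>lebesgue)"
    proof (intro nn_integral_mono)
      fix y
      have "(\<Sum>k\<in>F. c k * (indicator (A (k + 1)) x * (g y * indicator (- A k) y)))
          = (\<Sum>k\<in>F. ennreal ((N powr p / 2 * 2 powr (p * k)) *
              (indicat_real {z. N * 2 powr (k + 1) \<le> z} \<bar>u x\<bar> * indicat_real {z. z < N * 2 powr k} \<bar>u y\<bar>))) * g y"
        unfolding sum_distrib_right
        by (intro sum.cong) (auto simp: c_def A_def indicator_def)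
      also have "\<dots> \<le> ennreal (\<bar>u x - u y\<bar> powr p) * g y"
        using sum_levels_le_diff_powr[OF p N F, of "u x" "u y"]
        by (subst sum_ennreal) (auto intro!: mult_right_mono ennreal_leI)
      also have "\<dots> \<le> ennreal (\<bar>u x - u y\<bar> powr p * \<nu> (x - y))"
        using \<nu>0[of "x - y"] by (auto simp: g_def indicator_def ennreal_mult)
      finally show "(\<Sum>k\<in>F. c k * (indicator (A (k + 1)) x * (g y * indicator (- A k) y)))
         \<le> ennreal (\<bar>u x - u y\<bar> powr p * \<nu> (x - y))" .
    qed
    finally show ?thesis .
  qed
  have "(\<Sum>k\<in>F. c k * (ennreal (a (k + 1)) * nu_sharp \<nu> (a k)))
      = (\<integral>\<^sup>+x. (\<Sum>k\<in>F. c k * (indicator (A (k + 1)) x * nu_sharp \<nu> (a k))) \<partial>lebesgue)"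
    using A by (simp add: nn_integral_sum nn_integral_cmult nn_integral_multc eA)
  also have "\<dots> \<le> W_energy p \<nu> UNIV u"
    unfolding W_energy_def lebesgue_on_UNIV_eq by (intro nn_integral_mono inner)
  finally show ?thesis by (simp add: c_def)
qed

section \<open>The potential \<open>w\<close>, its inverse, and the consequences of
  convexity\<close>

lemma epow_ennreal: "0 \<le> x \<Longrightarrow> epow (ennreal x) a = ennreal (x powr a)"
  by (simp add: epow_def)

lemma one_divide_ennreal: "0 < x \<Longrightarrow> 1 / ennreal x = ennreal (1 / x)"
  using divide_ennreal[of 1 x] by simp

text \<open>Convexity with one endpoint at 0. Later uses of convexity, for \<open>\<phi>\<close> as
  well as for \<open>\<psi>\<close>, go through this star-shaped form.\<close>

lemma young_scale:
  assumes "young \<psi>" and "0 \<le> l" "l \<le> 1"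
  shows "\<psi> (ennreal l * x) \<le> ennreal l * \<psi> x"
proof -
  have "\<psi> (ennreal l * x + ennreal (1 - l) * 0) \<le> ennreal l * \<psi> x + ennreal (1 - l) * \<psi> 0"
    using assms unfolding young_def by blast
  then show ?thesis using assms(1) by (simp add: young_def)
qed

text \<open>The hypotheses on the kernel alone. The whole-space estimate is proved from these;
  \<open>\<Omega>\<close> and \<open>\<psi>\<close> enter afterwards.\<close>

locale sobolev_kernel =
  fixes p \<theta> :: real and \<nu> :: "'a::euclidean_space \<Rightarrow> real"
  assumes p: "1 \<le> p"
    and nu_measurable: "\<nu> \<in> borel_measurable (lebesgue_on (UNIV - {0}))"
    and nu_nonneg: "\<And>h. h \<noteq> 0 \<Longrightarrow> 0 \<le> \<nu> h"
    and bij: "bij_betw (w_pot p \<nu>) {0..} {..<\<infinity>}"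
    and young_phi: "young (\<lambda>t. phi p \<nu> (epow t (1 / p)))"
    and theta: "\<theta> > 0"
    and submult: "\<And>s t. 0 \<le> s \<Longrightarrow> s \<le> t \<Longrightarrow> 0 < t \<Longrightarrow>
           phi p \<nu> (ennreal (\<theta> * s / t)) \<le> phi p \<nu> (ennreal s) / phi p \<nu> (ennreal t)"
begin

text \<open>Real version of \<open>nu_sharp\<close>, faithful for \<open>a > 0\<close>. At 0, where
  \<open>nu_sharp\<close> may be infinite, its value is only met with a factor 0.\<close>

definition nu_tail :: "real \<Rightarrow> real"
  where "nu_tail a = enn2real (nu_sharp \<nu> a)"

definition W :: "real \<Rightarrow> real"
  where "W a = a * nu_tail a"

definition G :: "real \<Rightarrow> real"
  where "G x = enn2real (phi p \<nu> (ennreal (x powr (1 / p))))"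

lemma w_pot_zero: "w_pot p \<nu> 0 = 0" by (simp add: w_pot_def)

lemma nu_sharp_finite: "0 < a \<Longrightarrow> nu_sharp \<nu> a = ennreal (nu_tail a)"
proof -
  assume a: "0 < a"
  have "w_pot p \<nu> a \<in> {..<\<infinity>}"
    using bij a unfolding bij_betw_def by (metis atLeast_iff image_eqI less_imp_le)
  then have "ennreal a * nu_sharp \<nu> a \<noteq> \<infinity>" using a by (auto simp: w_pot_def epow_def split: if_splits)
  then have "nu_sharp \<nu> a < \<infinity>"
    using a by (auto simp: ennreal_mult_eq_top_iff less_top)
  then show ?thesis by (simp add: nu_tail_def)
qed

lemma nu_tail_nonneg: "0 \<le> nu_tail a" by (simp add: nu_tail_def)

lemma w_pot_eq: "0 < a \<Longrightarrow> w_pot p \<nu> a = ennreal (W a powr (1 / p))"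
  by (simp add: w_pot_def nu_sharp_finite W_def epow_ennreal nu_tail_nonneg flip: ennreal_mult)

lemma W_zero [simp]: "W 0 = 0" by (simp add: W_def)

lemma W_pos: "0 < a \<Longrightarrow> 0 < W a"
proof (rule ccontr)
  assume a: "0 < a" and "\<not> 0 < W a"
  then have "W a = 0" using nu_tail_nonneg[of a] by (simp add: W_def mult_le_0_iff not_less order_antisym)
  then have "w_pot p \<nu> a = w_pot p \<nu> 0" using a by (simp add: w_pot_eq w_pot_zero)
  then have "a = 0" using bij a by (auto simp: bij_betw_def inj_on_def)
  then show False using a by simp
qed

lemma W_nonneg: "0 \<le> a \<Longrightarrow> 0 \<le> W a"
  by (simp add: W_def nu_tail_nonneg)

lemma phi_zero: "phi p \<nu> 0 = 0" by (simp add: phi_def)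

text \<open>Surjectivity of \<open>w\<close> provides a preimage of \<open>1 / t\<close>, which is
  not 0 because \<open>w\<close> vanishes there.\<close>

lemma phi_finite_pos:
  assumes "0 < t"
  shows "\<exists>y>0. phi p \<nu> (ennreal t) = ennreal y"
proof -
  define g where "g = the_inv_into {0..} (w_pot p \<nu>) (ennreal (1 / t))"
  have mem: "ennreal (1 / t) \<in> w_pot p \<nu> ` {0..}" using bij by (auto simp: bij_betw_def)
  have inj: "inj_on (w_pot p \<nu>) {0..}" using bij by (simp add: bij_betw_def)
  have g: "w_pot p \<nu> g = ennreal (1 / t)" "g \<in> {0..}"
    unfolding g_def using f_the_inv_into_f[OF inj mem] the_inv_into_into[OF inj mem] by auto
  then have "g \<noteq> 0" using assms by (auto simp: w_pot_zero)
  with g have "0 < g" by simp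
  then show ?thesis
    using assms by (intro exI[of _ "1 / g"]) (simp add: phi_def one_divide_ennreal g_def)
qed

lemma phi_G: "0 \<le> t \<Longrightarrow> phi p \<nu> (ennreal t) = ennreal (G (t powr p))"
  using phi_finite_pos[of t] p by (cases "t = 0") (auto simp: G_def phi_zero powr_powr)

lemma G_zero [simp]: "G 0 = 0" by (simp add: G_def phi_zero)

lemma G_pos: "0 < x \<Longrightarrow> 0 < G x"
  using phi_finite_pos[of "x powr (1 / p)"] by (auto simp: G_def)

lemma G_scale:
  assumes "0 \<le> l" "l \<le> 1" "0 \<le> x"
  shows "G (l * x) \<le> l * G x"
proof -
  have G: "phi p \<nu> (epow (ennreal y) (1 / p)) = ennreal (G y)" if "0 \<le> y" for y
    using phi_G[of "y powr (1 / p)"] that p by (simp add: epow_ennreal powr_powr)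
  have "ennreal (G (l * x)) \<le> ennreal (l * G x)"
    using young_scale[OF young_phi assms(1,2), of "ennreal x"] assms
    by (simp add: G enn2real_nonneg flip: ennreal_mult')
  moreover have "0 \<le> l * G x" using assms by (simp add: G_def)
  ultimately show ?thesis by (subst (asm) ennreal_le_iff) auto
qed

lemma G_mono:
  assumes "0 \<le> x" "x \<le> y"
  shows "G x \<le> G y"
proof (cases "y = 0")
  case False
  then have "G (x / y * y) \<le> x / y * G y" using assms by (intro G_scale) auto
  also have "\<dots> \<le> 1 * G y" using assms False by (intro mult_right_mono) (auto simp: G_def)
  finally show ?thesis using False by simp
qed (use assms in auto)

text \<open>The definition of \<open>\<phi>\<close> says \<open>\<phi>(1 / w(a)) = 1 / a\<close>.
  This identity is what turns convexity of \<open>G\<close> into information on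
  \<open>W\<close>.\<close>

lemma G_inverse_W:
  assumes "0 < a"
  shows "G (1 / W a) = 1 / a"
proof -
  have inj: "inj_on (w_pot p \<nu>) {0..}" using bij by (simp add: bij_betw_def)
  have "(1 / W a) powr (1 / p) = 1 / W a powr (1 / p)" using W_pos[OF assms] by (simp add: powr_divide)
  then have "phi p \<nu> (ennreal ((1 / W a) powr (1 / p))) = 1 / ennreal a"
    using W_pos[OF assms] assms the_inv_into_f_f[OF inj, of a]
    by (simp add: phi_def one_divide_ennreal w_pot_eq)
  then show ?thesis using assms by (simp add: G_def one_divide_ennreal)
qed

text \<open>If \<open>W a < W a'\<close>, then \<open>1 / W a'\<close> is a proper fraction of
  \<open>1 / W a\<close>, and scaling \<open>G\<close> gives \<open>1 / a' < 1 / a\<close>, against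
  \<open>a' \<le> a\<close>.\<close>

lemma W_mono:
  assumes "0 \<le> a'" "a' \<le> a"
  shows "W a' \<le> W a"
proof (rule ccontr)
  assume "\<not> W a' \<le> W a"
  then have lt: "W a < W a'" by simp
  then have a': "0 < a'" "0 < a" using assms W_nonneg[of a] by (auto simp: order_le_less)
  have "1 / a' = G (W a / W a' * (1 / W a))" using G_inverse_W[OF a'(1)] W_pos[OF a'(2)] by simp
  also have "\<dots> \<le> W a / W a' * (1 / a)"
    using G_scale[of "W a / W a'" "1 / W a"] G_inverse_W[OF a'(2)] lt W_pos[OF a'(2)] by simp
  also have "\<dots> < 1 * (1 / a)" using lt W_pos[OF a'(2)] a' by (intro mult_strict_right_mono) auto
  finally show False using assms a' by (simp add: field_simps)
qed

text \<open>Scaling \<open>G\<close> from \<open>1 / W 1\<close> down to \<open>1 / W a\<close>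
  shows that \<open>W\<close> grows at most linearly beyond 1. This controls the low dyadic levels,
  whose measure may be large.\<close>

lemma W_le_linear:
  assumes "0 \<le> a"
  shows "W a \<le> W 1 * max 1 a"
proof (cases "a \<le> 1")
  case True
  then show ?thesis using W_mono[OF assms, of 1] by simp
next
  case False
  have "1 / a = G (W 1 / W a * (1 / W 1))" using G_inverse_W[of a] W_pos[of 1] False by simp
  also have "\<dots> \<le> W 1 / W a * 1"
    using G_scale[of "W 1 / W a" "1 / W 1"] G_inverse_W[of 1] W_pos[of 1] W_pos[of a] W_mono[of 1 a] False
    by simp
  finally show ?thesis using False W_pos[of a] by (simp add: field_simps)
qed

text \<open>The hypothesis on \<open>\<phi>\<close> at \<open>s = 1 / w(a)\<close> and
  \<open>t = 1 / w(a')\<close>, where \<open>\<phi>\<close> takes the values \<open>1 / a\<close>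
  and \<open>1 / a'\<close>; the order \<open>s \<le> t\<close> comes from
  \<open>W_mono\<close>.\<close>

lemma W_submult:
  assumes "0 < a'" "a' \<le> a"
  shows "G (\<theta> powr p * W a' / W a) \<le> a' / a"
proof -
  have W: "0 < W a'" "0 < W a" using assms W_pos by auto
  define s where "s = (1 / W a) powr (1 / p)"
  define t where "t = (1 / W a') powr (1 / p)"
  have st: "0 < s" "0 < t" using W by (auto simp: s_def t_def)
  have powr: "s powr p = 1 / W a" "t powr p = 1 / W a'"
    using W p by (auto simp: s_def t_def powr_powr)
  have "s \<le> t"
    unfolding s_def t_def using W_mono[of a' a] assms W p by (intro powr_mono2) (auto simp: frac_le)
  then have "phi p \<nu> (ennreal (\<theta> * s / t)) \<le> phi p \<nu> (ennreal s) / phi p \<nu> (ennreal t)"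
    using st by (intro submult) auto
  moreover have "(\<theta> * s / t) powr p = \<theta> powr p * W a' / W a"
    using theta st powr W by (simp add: powr_divide powr_mult)
  ultimately have "ennreal (G (\<theta> powr p * W a' / W a)) \<le> ennreal (1 / a) / ennreal (1 / a')"
    using st theta assms by (simp add: phi_G powr G_inverse_W)
  then show ?thesis using assms by (simp add: divide_ennreal)
qed

text \<open>
  \<open>W_submult\<close> puts \<open>\<theta>\<^sup>p W a' / W a\<close> in a sublevel set of \<open>G\<close>, and by star-shapedness \<open>G\<close> grows at
  least linearly away from 0. A small \<open>\<epsilon>\<close> later lets the first term be absorbed when summing over
  dyadic levels.
\<close>

lemma W_interpolation:
  assumes "0 < \<epsilon>"
  shows "\<exists>K\<ge>0. \<forall>a a'. 0 \<le> a' \<and> a' \<le> a \<longrightarrow> W a' \<le> \<epsilon> * W a + K * (a' * nu_tail a)"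
proof -
  \<comment> \<open>Chosen so that multiplication by \<open>W a / \<theta> powr p\<close> turns the
    threshold \<open>\<delta>\<close> into \<open>\<epsilon> * W a\<close>.\<close>
  define \<delta> where "\<delta> = \<theta> powr p * \<epsilon>"
  have \<delta>: "0 < \<delta>" using assms theta by (simp add: \<delta>_def)
  define K where "K = \<epsilon> / G \<delta>"
  have K: "0 \<le> K" using assms G_pos[OF \<delta>] by (simp add: K_def)
  have "W a' \<le> \<epsilon> * W a + K * (a' * nu_tail a)" if a: "0 \<le> a'" "a' \<le> a" for a a'
  proof (cases "a' = 0")
    case True
    then show ?thesis using a assms W_nonneg[of a] by simp
  next
    case False
    then have a': "0 < a'" "0 < a" using a by auto
    have W: "0 < W a'" "0 < W a" using a' W_pos by auto
    define y where "y = \<theta> powr p * W a' / W a"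
    have y: "0 < y" using W theta by (simp add: y_def)
    have "y \<le> \<delta> + \<delta> / G \<delta> * (a' / a)"
    proof (cases "y \<le> \<delta>")
      case False
      have "G \<delta> \<le> \<delta> / y * G y" using G_scale[of "\<delta> / y" y] False \<delta> y by simp
      also have "\<dots> \<le> \<delta> / y * (a' / a)"
        using W_submult[OF a'(1) a(2), folded y_def] \<delta> y by (intro mult_left_mono) auto
      finally have "y \<le> \<delta> / G \<delta> * (a' / a)" using y G_pos[OF \<delta>] a' by (simp add: field_simps)
      then show ?thesis using \<delta> by simp
    next
      case True
      moreover have "0 \<le> \<delta> / G \<delta> * (a' / a)" using \<delta> G_pos[OF \<delta>] a' by simp
      ultimately show ?thesis by linarith
    qed
    then have "W a / \<theta> powr p * y \<le> W a / \<theta> powr p * (\<delta> + \<delta> / G \<delta> * (a' / a))"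
      using W theta by (intro mult_left_mono) auto
    also have "W a / \<theta> powr p * y = W a'" using W theta by (simp add: y_def)
    also have "W a / \<theta> powr p * (\<delta> + \<delta> / G \<delta> * (a' / a)) = \<epsilon> * W a + K * (a' * (W a / a))"
      using theta by (simp add: \<delta>_def K_def field_simps)
    also have "W a / a = nu_tail a" using a' by (simp add: W_def)
    finally show ?thesis .
  qed
  with K show ?thesis by blast
qed

section \<open>Summation over dyadic levels and the modular bound on the whole space\<close>

text \<open>The weighted terms satisfy \<open>s (k + 1) \<le> s k / 2\<close> plus a multiple of the
  energy term. Summing over an interval of levels absorbs the half, leaving the energy and the
  lowest term. The constant is independent of \<open>a\<close> and \<open>F\<close>.\<close>

lemma level_sum_bound:
  obtains C where "1 \<le> C" and "\<And>(a :: int \<Rightarrow> real) F.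
     (\<And>k. 0 \<le> a (k + 1)) \<Longrightarrow> (\<And>k. a (k + 1) \<le> a k) \<Longrightarrow> (\<And>k. 2 powr (p * k) * a k \<le> 1) \<Longrightarrow>
     (\<And>F. finite F \<Longrightarrow> (\<Sum>k\<in>F. 2 powr (p * k) * (a (k + 1) * nu_tail (a k))) \<le> 2) \<Longrightarrow>
     finite F \<Longrightarrow> (\<Sum>k\<in>F. 2 powr (p * k) * W (a k)) \<le> C"
proof -
  define T where "T = 2 powr p"
  have T: "0 < T" by (simp add: T_def)
  \<comment> \<open>Passing from \<open>k\<close> to \<open>k + 1\<close> multiplies the weight by
    \<open>T\<close>, so \<open>\<epsilon> = 1 / (2 * T)\<close> leaves the factor 1/2.\<close>
  obtain K where K: "0 \<le> K"
    "\<And>a a'. 0 \<le> a' \<Longrightarrow> a' \<le> a \<Longrightarrow> W a' \<le> 1 / (2 * T) * W a + K * (a' * nu_tail a)"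
    using W_interpolation[of "1 / (2 * T)"] T by auto
  define C where "C = max 1 (2 * W 1 + 4 * T * K)"
  have "(\<Sum>k\<in>F. 2 powr (p * k) * W (a k)) \<le> C"
    if a: "\<And>k. 0 \<le> a (k + 1)" "\<And>k. a (k + 1) \<le> a k" "\<And>k. 2 powr (p * k) * a k \<le> 1"
      and e: "\<And>F. finite F \<Longrightarrow> (\<Sum>k\<in>F. 2 powr (p * k) * (a (k + 1) * nu_tail (a k))) \<le> 2"
      and F: "finite F" for a :: "int \<Rightarrow> real" and F :: "int set"
  proof -
    define s where "s k = 2 powr (p * k) * W (a k)" for k :: int
    have a0: "0 \<le> a k" for k using a(1)[of "k - 1"] by simp
    have s0: "0 \<le> s k" for k using W_nonneg[OF a0] by (simp add: s_def)
    have step: "s (k + 1) \<le> s k / 2 + T * K * (2 powr (p * k) * (a (k + 1) * nu_tail (a k)))" for k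
    proof -
      have "s (k + 1) = T * 2 powr (p * k) * W (a (k + 1))"
        by (simp add: s_def T_def distrib_left powr_add)
      also have "\<dots> \<le> T * 2 powr (p * k) * (1 / (2 * T) * W (a k) + K * (a (k + 1) * nu_tail (a k)))"
        using K(2)[OF a(1,2)] T by (intro mult_left_mono) auto
      also have "\<dots> = s k / 2 + T * K * (2 powr (p * k) * (a (k + 1) * nu_tail (a k)))"
        using T by (simp add: s_def field_simps)
      finally show ?thesis .
    qed
    \<comment> \<open>Inserting 0 makes the lowest level nonpositive, so that
      \<open>2 powr (p * m) \<le> 1\<close>.\<close>
    define m where "m = Min (insert 0 F)"
    define n where "n = Max (insert 0 F)"
    have m: "m \<le> 0" "0 \<le> n" "F \<subseteq> {m..n}" using F by (auto simp: m_def n_def)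
    have "p * m \<le> 0" using p m by (simp add: mult_nonneg_nonpos)
    then have Tm: "2 powr (p * m) \<le> 2 powr 0" by (intro powr_mono) auto
    \<comment> \<open>The linear growth of \<open>W\<close> is matched by the bound
      \<open>2 powr (p * m) * a m \<le> 1\<close>, so the starting term does not depend on
      \<open>m\<close>.\<close>
    have "s m \<le> 2 powr (p * m) * (W 1 * max 1 (a m))"
      unfolding s_def by (intro mult_left_mono W_le_linear a0) auto
    also have "\<dots> = W 1 * max (2 powr (p * m)) (2 powr (p * m) * a m)"
      using W_nonneg[of 1] by (simp add: max_mult_distrib_left mult_ac)
    also have "\<dots> \<le> W 1 * 1"
      using Tm a(3)[of m] W_nonneg[of 1] by (intro mult_left_mono) auto
    finally have sm: "s m \<le> W 1" by simp
    have "{m..n} = insert m {m + 1..<n + 1}" using m by auto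
    moreover have "(\<Sum>k\<in>{m + 1..<n + 1}. s k) = (\<Sum>k\<in>{m..<n}. s (k + 1))"
      by (rule sum.reindex_bij_witness[of _ "\<lambda>k. k + 1" "\<lambda>k. k - 1"]) auto
    ultimately have "(\<Sum>k\<in>{m..n}. s k) = s m + (\<Sum>k\<in>{m..<n}. s (k + 1))"
      by simp
    also have "(\<Sum>k\<in>{m..<n}. s (k + 1))
      \<le> (\<Sum>k\<in>{m..<n}. s k / 2 + T * K * (2 powr (p * k) * (a (k + 1) * nu_tail (a k))))"
      by (intro sum_mono step)
    also have "\<dots> = (\<Sum>k\<in>{m..<n}. s k) / 2
        + T * K * (\<Sum>k\<in>{m..<n}. 2 powr (p * k) * (a (k + 1) * nu_tail (a k)))"
      by (simp add: sum.distrib sum_divide_distrib sum_distrib_left)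
    also have "\<dots> \<le> (\<Sum>k\<in>{m..n}. s k) / 2 + T * K * 2"
      using e[of "{m..<n}"] T K s0
      by (intro add_mono divide_right_mono mult_left_mono sum_mono2) auto
    finally have "(\<Sum>k\<in>{m..n}. s k) \<le> 2 * W 1 + 4 * T * K" using sm by simp
    moreover have "(\<Sum>k\<in>F. s k) \<le> (\<Sum>k\<in>{m..n}. s k)" using m s0 by (intro sum_mono2) auto
    ultimately show ?thesis by (simp add: s_def C_def)
  qed
  moreover have "1 \<le> C" by (simp add: C_def)
  ultimately show thesis using that[of C] by blast
qed

text \<open>\<open>N\<close> is any positive bound for the norm rather than the norm itself, so
  functions of norm 0 need no separate case. \<open>K\<close> depends on the kernel and the
  exponents only.\<close>

lemma phi_modular_bound:
  "\<exists>K\<ge>1. \<forall>u N. u \<in> borel_measurable lebesgue \<and> 0 < N \<and>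
      Lp_power p UNIV u \<le> ennreal (N powr p) \<and> W_energy p \<nu> UNIV u \<le> ennreal (N powr p) \<longrightarrow>
      (\<exists>g\<in>borel_measurable lebesgue.
         (\<forall>x. phi p \<nu> (ennreal (\<bar>u x\<bar> / (K * N))) \<le> g x) \<and> (\<integral>\<^sup>+x. g x \<partial>lebesgue) \<le> 1)"
proof (rule level_sum_bound)
  fix C :: real
  assume C: "1 \<le> C" and level: "\<And>(a :: int \<Rightarrow> real) F.
     (\<And>k. 0 \<le> a (k + 1)) \<Longrightarrow> (\<And>k. a (k + 1) \<le> a k) \<Longrightarrow> (\<And>k. 2 powr (p * k) * a k \<le> 1) \<Longrightarrow>
     (\<And>F. finite F \<Longrightarrow> (\<Sum>k\<in>F. 2 powr (p * k) * (a (k + 1) * nu_tail (a k))) \<le> 2) \<Longrightarrow>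
     finite F \<Longrightarrow> (\<Sum>k\<in>F. 2 powr (p * k) * W (a k)) \<le> C"
  \<comment> \<open>The factor 2 pays for rounding \<open>\<bar>u x\<bar> / N\<close> down to a
    power of 2; \<open>C powr (1 / p)\<close> normalizes the level sum to 1.\<close>
  define K where "K = 2 * C powr (1 / p)"
  have "1 \<le> C powr (1 / p)" using C p by (intro ge_one_powr_ge_zero) auto
  then have K1: "1 \<le> K" by (simp add: K_def)
  have "\<exists>g\<in>borel_measurable lebesgue.
         (\<forall>x. phi p \<nu> (ennreal (\<bar>u x\<bar> / (K * N))) \<le> g x) \<and> (\<integral>\<^sup>+x. g x \<partial>lebesgue) \<le> 1"
    if u: "u \<in> borel_measurable lebesgue" and N: "0 < N"
      and Lp: "Lp_power p UNIV u \<le> ennreal (N powr p)"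
      and En: "W_energy p \<nu> UNIV u \<le> ennreal (N powr p)" for u :: "'a \<Rightarrow> real" and N
  proof -
    define A where "A k = {x. N * 2 powr (k::int) \<le> \<bar>u x\<bar>}" for k
    define a where "a k = measure lebesgue (A k)" for k
    have A [measurable]: "A k \<in> sets lebesgue" for k
    proof -
      have "{x \<in> space lebesgue. N * 2 powr (k::int) \<le> \<bar>u x\<bar>} \<in> sets lebesgue" using u by measurable
      then show ?thesis
        unfolding A_def by (simp only: space_completion space_lborel space_borel UNIV_I simp_thms)
    qed
    \<comment> \<open>Chebyshev's inequality.\<close>
    have Lpk: "ennreal (N powr p * 2 powr (p * k)) * emeasure lebesgue (A k) \<le> ennreal (N powr p)" for k
    proof -
      have "ennreal (N powr p * 2 powr (p * k)) * emeasure lebesgue (A k)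
          = (\<integral>\<^sup>+x. ennreal (N powr p * 2 powr (p * k)) * indicator (A k) x \<partial>lebesgue)"
        by (rule nn_integral_cmult_indicator[symmetric]) (rule A)
      also have "\<dots> \<le> (\<integral>\<^sup>+x. ennreal (\<bar>u x\<bar> powr p) \<partial>lebesgue)"
      proof (intro nn_integral_mono)
        fix x
        show "ennreal (N powr p * 2 powr (p * k)) * indicator (A k) x \<le> ennreal (\<bar>u x\<bar> powr p)"
        proof (cases "x \<in> A k")
          case True
          then have "(N * 2 powr k) powr p \<le> \<bar>u x\<bar> powr p"
            unfolding A_def using N p by (intro powr_mono2) auto
          then show ?thesis using True N by (simp add: powr_mult powr_powr mult.commute ennreal_leI)
        qed simp
      qed
      also have "\<dots> \<le> ennreal (N powr p)" using Lp by (simp add: Lp_power_def lebesgue_on_UNIV_eq)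
      finally show ?thesis .
    qed
    have "emeasure lebesgue (A k) \<noteq> \<infinity>" for k
      using Lpk[of k] N by (auto simp: ennreal_mult_top top_unique)
    then have ea: "emeasure lebesgue (A k) = ennreal (a k)" for k
      by (simp add: a_def emeasure_eq_ennreal_measure)
    have a0: "0 \<le> a k" for k by (simp add: a_def)
    have Asub: "A (k + 1) \<subseteq> A k" for k
    proof -
      have "N * 2 powr k \<le> N * 2 powr (k + 1)" using N by (intro mult_left_mono powr_mono) auto
      then show ?thesis unfolding A_def by (intro Collect_mono impI) linarith
    qed
    have a_mono: "a (k + 1) \<le> a k" for k
      using emeasure_mono[OF Asub A, of k] by (simp add: ea a0)
    have a_le: "2 powr (p * k) * a k \<le> 1" for k
    proof -
      have "N powr p * 2 powr (p * k) * a k \<le> N powr p"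
        using Lpk[of k] a0 by (simp add: ea flip: ennreal_mult)
      then show ?thesis using N by (simp add: mult.assoc)
    qed
    have a_energy: "(\<Sum>k\<in>F. 2 powr (p * k) * (a (k + 1) * nu_tail (a k))) \<le> 2" if F: "finite F" for F
    proof -
      \<comment> \<open>If \<open>a k = 0\<close>, then \<open>nu_sharp\<close> may be infinite
        there, but \<open>a (k + 1) = 0\<close> makes both products vanish.\<close>
      have eq: "ennreal (a (k + 1)) * nu_sharp \<nu> (a k) = ennreal (a (k + 1) * nu_tail (a k))" for k
      proof (cases "a k = 0")
        case True
        then have "a (k + 1) = 0" using a_mono[of k] a0[of "k + 1"] by simp
        then show ?thesis by simp
      next
        case False
        then show ?thesis
          using nu_sharp_finite[of "a k"] a0[of k] a0[of "k + 1"] nu_tail_nonneg by (simp add: ennreal_mult)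
      qed
      have "(\<Sum>k\<in>F. ennreal (N powr p / 2 * 2 powr (p * k)) * (ennreal (a (k + 1)) * nu_sharp \<nu> (a k)))
         \<le> W_energy p \<nu> UNIV u"
        by (rule W_energy_ge_levels[OF p N F nu_measurable nu_nonneg u]) (assumption | rule ea[unfolded A_def] a0)+
      also note En
      also have "(\<Sum>k\<in>F. ennreal (N powr p / 2 * 2 powr (p * k)) * (ennreal (a (k + 1)) * nu_sharp \<nu> (a k)))
          = (\<Sum>k\<in>F. ennreal (N powr p / 2 * (2 powr (p * k) * (a (k + 1) * nu_tail (a k)))))"
        unfolding eq by (intro sum.cong refl) (simp add: mult.assoc nu_tail_nonneg a0 flip: ennreal_mult)
      also have "\<dots> = ennreal (N powr p / 2 * (\<Sum>k\<in>F. 2 powr (p * k) * (a (k + 1) * nu_tail (a k))))"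
        by (subst sum_ennreal) (auto simp: sum_distrib_left nu_tail_nonneg a0)
      finally have "N powr p / 2 * (\<Sum>k\<in>F. 2 powr (p * k) * (a (k + 1) * nu_tail (a k))) \<le> N powr p"
        by (subst (asm) ennreal_le_iff) auto
      then show ?thesis using N by (simp add: field_simps)
    qed
    have sumW: "(\<Sum>k\<in>F. 2 powr (p * k) * W (a k)) \<le> C" if "finite F" for F
      by (rule level) (use a0 a_mono a_le a_energy that in auto)
    \<comment> \<open>A single term of the level sum is at most \<open>C\<close>, so
      \<open>2 powr (p * k) / C\<close> is a fraction \<open>l \<le> 1\<close> of
      \<open>1 / W (a k)\<close>, where \<open>G\<close> is known.\<close>
    have term_le: "G (2 powr (p * k) / C) * a k \<le> 2 powr (p * k) * W (a k) / C" for k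
    proof (cases "a k = 0")
      case False
      then have ak: "0 < a k" using a0[of k] by simp
      define l where "l = 2 powr (p * k) * W (a k) / C"
      have "2 powr (p * k) * W (a k) \<le> C" using sumW[of "{k}"] by simp
      then have l: "0 \<le> l" "l \<le> 1" using C W_pos[OF ak] by (auto simp: l_def)
      have "G (2 powr (p * k) / C) = G (l * (1 / W (a k)))" using W_pos[OF ak] by (simp add: l_def)
      also have "\<dots> \<le> l * (1 / a k)"
        using G_scale[OF l, of "1 / W (a k)"] W_pos[OF ak] G_inverse_W[OF ak] by simp
      finally show ?thesis using ak unfolding l_def[symmetric] by (simp add: pos_le_divide_eq)
    qed simp
    \<comment> \<open>A measurable majorant, so that the measurability of \<open>\<phi> \<circ> \<bar>u\<bar>\<close> is never needed.\<close>
    define g where "g x = (\<Sum>n. ennreal (G (2 powr (p * int_decode n) / C)) * indicator (A (int_decode n)) x)" for x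
    have g: "g \<in> borel_measurable lebesgue" unfolding g_def by measurable
    have "phi p \<nu> (ennreal (\<bar>u x\<bar> / (K * N))) \<le> g x" for x
    proof (cases "u x = 0")
      case False
      \<comment> \<open>The dyadic level of \<open>\<bar>u x\<bar> / N\<close>. The term of
        \<open>g\<close> with this index alone dominates the left side.\<close>
      define k where "k = \<lfloor>log 2 (\<bar>u x\<bar> / N)\<rfloor>"
      define r where "r = \<bar>u x\<bar> / N"
      have r: "0 < r" "\<bar>u x\<bar> = N * r" using False N by (auto simp: r_def)
      have "k \<le> log 2 r" "log 2 r < k + 1" by (auto simp: k_def r_def)
      then have "2 powr k \<le> r" "r < 2 powr (k + 1)"
        using r by (simp_all add: le_log_iff log_less_iff)
      then have xA: "x \<in> A k" and r2: "r \<le> 2 * 2 powr k"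
        using r N by (auto simp: A_def powr_add)
      have "phi p \<nu> (ennreal (\<bar>u x\<bar> / (K * N))) = ennreal (G ((r / K) powr p))"
        using N K1 r by (subst phi_G) auto
      also have "\<dots> \<le> ennreal (G (2 powr (p * k) / C))"
      proof (intro ennreal_leI G_mono)
        have "(r / K) powr p \<le> (2 * 2 powr k / K) powr p"
          using r r2 K1 p by (intro powr_mono2 divide_right_mono) auto
        also have "\<dots> = 2 powr (p * k) / C"
          using C p by (simp add: K_def powr_divide powr_powr mult.commute)
        finally show "(r / K) powr p \<le> 2 powr (p * k) / C" .
      qed simp
      also have "\<dots> = (\<Sum>n\<in>{int_encode k}. ennreal (G (2 powr (p * int_decode n) / C)) * indicator (A (int_decode n)) x)"
        using xA by simp
      also have "\<dots> \<le> g x" unfolding g_def by (rule sum_le_suminf) auto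
      finally show ?thesis .
    qed (simp add: phi_zero)
    moreover have "(\<integral>\<^sup>+x. g x \<partial>lebesgue) \<le> 1"
    proof -
      have "(\<integral>\<^sup>+x. g x \<partial>lebesgue)
          = (\<Sum>n. ennreal (G (2 powr (p * int_decode n) / C)) * emeasure lebesgue (A (int_decode n)))"
        unfolding g_def by (simp add: nn_integral_suminf nn_integral_cmult)
      also have "\<dots> = (\<Sum>n. ennreal (G (2 powr (p * int_decode n) / C) * a (int_decode n)))"
        by (simp add: ea a0 G_def ennreal_mult)
      also have "\<dots> \<le> 1"
      proof (rule suminf_le_const)
        fix n
        have "(\<Sum>i<n. ennreal (G (2 powr (p * int_decode i) / C) * a (int_decode i)))
            \<le> (\<Sum>i<n. ennreal (2 powr (p * int_decode i) * W (a (int_decode i)) / C))"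
          by (intro sum_mono ennreal_leI term_le)
        also have "\<dots> = ennreal ((\<Sum>i<n. 2 powr (p * int_decode i) * W (a (int_decode i))) / C)"
          using C W_nonneg[OF a0] by (subst sum_ennreal) (auto simp: sum_divide_distrib)
        \<comment> \<open>The enumeration of the integers is injective, so a partial sum is a sum
          over a finite set of levels.\<close>
        also have "(\<Sum>i<n. 2 powr (p * int_decode i) * W (a (int_decode i)))
            = (\<Sum>k\<in>int_decode ` {..<n}. 2 powr (p * k) * W (a k))"
          by (subst sum.reindex) (auto simp: inj_int_decode)
        also have "ennreal (\<dots> / C) \<le> ennreal 1"
          using sumW[of "int_decode ` {..<n}"] C by (intro ennreal_leI) simp
        finally show "(\<Sum>i<n. ennreal (G (2 powr (p * int_decode i) / C) * a (int_decode i))) \<le> 1" by simp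
      qed simp
      finally show ?thesis .
    qed
    ultimately show ?thesis using g by blast
  qed
  with K1 show ?thesis by blast
qed

end

section \<open>From the whole space to extension domains and Luxemburg norms\<close>

lemma epow_leD:
  assumes "epow x (1 / p) \<le> ennreal M" "0 < p" "0 \<le> M"
  shows "x \<le> ennreal (M powr p)"
proof (cases x)
  case (real r)
  then have "r powr (1 / p) \<le> M" using assms by (simp add: epow_ennreal)
  then have "(r powr (1 / p)) powr p \<le> M powr p" using assms by (intro powr_mono2) auto
  then show ?thesis using real assms by (simp add: powr_powr ennreal_leI)
qed (use assms in \<open>simp add: epow_def top_unique\<close>)

lemma young_mono:
  assumes "young \<psi>" "0 \<le> s" "s \<le> t"
  shows "\<psi> (ennreal s) \<le> \<psi> (ennreal t)"
proof (cases "t = 0")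
  case False
  then have "\<psi> (ennreal (s / t) * ennreal t) \<le> ennreal (s / t) * \<psi> (ennreal t)"
    using assms by (intro young_scale) auto
  also have "\<dots> \<le> 1 * \<psi> (ennreal t)"
    using assms False by (intro mult_right_mono) (auto simp flip: ennreal_1)
  finally show ?thesis using False assms by (simp flip: ennreal_mult)
qed (use assms in simp)

context sobolev_kernel
begin

text \<open>The additive constant \<open>A\<close> lets one statement serve both embeddings:
  \<open>A = 0\<close> for arbitrary \<open>\<Omega>\<close>, where
  \<open>0 * \<infinity> = 0\<close>, and \<open>A > 0\<close> when \<open>\<Omega>\<close> has
  finite measure. The growth bound is integrated for the extended function, and convexity divides
  the total by its bound \<open>B\<close>.\<close>

lemma extension_orlicz_modular_bound:
  fixes A c :: real
  assumes ext: "extension_domain p \<nu> \<Omega>" and \<psi>: "young \<psi>"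
    and A: "0 \<le> A" "ennreal A * emeasure lebesgue \<Omega> < \<infinity>" and c: "0 < c"
    and growth: "\<And>t. 0 \<le> t \<Longrightarrow>
       \<psi> (ennreal (c * t)) \<le> ennreal A + (ennreal (t powr p) + phi p \<nu> (ennreal t))"
  shows "\<exists>D>0. \<forall>u\<in>W_space p \<nu> \<Omega>. \<forall>N>0. W_norm p \<nu> \<Omega> u \<le> ennreal N \<longrightarrow>
           orlicz_modular \<Omega> \<psi> (\<lambda>x. u x / (D * N)) \<le> 1"
proof -
  obtain K where K: "1 \<le> K" and mod: "\<And>u N. u \<in> borel_measurable lebesgue \<Longrightarrow> 0 < N \<Longrightarrow>
      Lp_power p UNIV u \<le> ennreal (N powr p) \<Longrightarrow> W_energy p \<nu> UNIV u \<le> ennreal (N powr p) \<Longrightarrow>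
      \<exists>g\<in>borel_measurable lebesgue.
         (\<forall>x. phi p \<nu> (ennreal (\<bar>u x\<bar> / (K * N))) \<le> g x) \<and> (\<integral>\<^sup>+x. g x \<partial>lebesgue) \<le> 1"
    using phi_modular_bound by blast
  obtain E C0 where \<Omega>: "open \<Omega>" and EW: "\<And>u. u \<in> W_space p \<nu> \<Omega> \<Longrightarrow> E u \<in> W_space p \<nu> UNIV"
    and Eeq: "\<And>u. u \<in> W_space p \<nu> \<Omega> \<Longrightarrow> AE x in lebesgue_on \<Omega>. E u x = u x"
    and Enorm: "\<And>u. u \<in> W_space p \<nu> \<Omega> \<Longrightarrow> W_norm p \<nu> UNIV (E u) \<le> ennreal C0 * W_norm p \<nu> \<Omega> u"
    using ext unfolding extension_domain_def by metis
  have \<Omega>m: "\<Omega> \<in> sets lebesgue" using \<Omega> by simp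
  define C where "C = max 1 C0"
  \<comment> \<open>The summand 2 covers the power term and the \<open>\<phi>\<close> term, each of
    integral at most 1. In \<open>D\<close>, the factor \<open>K\<close> comes from the
    \<open>\<phi>\<close> bound, \<open>C\<close> from the extension and \<open>c\<close> from the
    growth condition.\<close>
  define B where "B = 2 + enn2real (ennreal A * emeasure lebesgue \<Omega>)"
  define D where "D = B * K * C / c"
  have C: "1 \<le> C" and B: "1 \<le> B" by (simp_all add: C_def B_def)
  have "orlicz_modular \<Omega> \<psi> (\<lambda>x. u x / (D * N)) \<le> 1"
    if u: "u \<in> W_space p \<nu> \<Omega>" and N: "0 < N" and norm: "W_norm p \<nu> \<Omega> u \<le> ennreal N" for u N
  proof -
    define v where "v = E u"
    define M where "M = C * N"
    have M: "0 < M" using C N by (simp add: M_def)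
    have v: "v \<in> borel_measurable lebesgue"
      using EW[OF u] by (simp add: v_def W_space_def lebesgue_on_UNIV_eq)
    have "W_norm p \<nu> UNIV v \<le> ennreal C0 * W_norm p \<nu> \<Omega> u" unfolding v_def by (rule Enorm[OF u])
    also have "\<dots> \<le> ennreal C * ennreal N"
      using norm by (intro mult_mono) (auto simp: C_def ennreal_leI)
    also have "\<dots> = ennreal M" using C N by (simp add: M_def ennreal_mult)
    finally have "Lp_power p UNIV v + W_energy p \<nu> UNIV v \<le> ennreal (M powr p)"
      unfolding W_norm_def using p M by (intro epow_leD) auto
    then have Lp: "Lp_power p UNIV v \<le> ennreal (M powr p)"
      and En: "W_energy p \<nu> UNIV v \<le> ennreal (M powr p)"
      by (auto intro: order_trans[rotated])
    obtain g where g [measurable]: "g \<in> borel_measurable lebesgue"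
      and phi_g: "\<And>x. phi p \<nu> (ennreal (\<bar>v x\<bar> / (K * M))) \<le> g x"
      and int_g: "(\<integral>\<^sup>+x. g x \<partial>lebesgue) \<le> 1"
      using mod[OF v M Lp En] by blast
    define t where "t x = \<bar>v x\<bar> / (K * M)" for x
    have t0: "0 \<le> t x" for x using K M by (simp add: t_def)
    have vp [measurable]: "(\<lambda>x. ennreal (\<bar>v x\<bar> powr p)) \<in> borel_measurable lebesgue"
      using v by measurable
    define q where "q x = ennreal (1 / M powr p) * ennreal (\<bar>v x\<bar> powr p)" for x
    have q [measurable]: "q \<in> borel_measurable lebesgue" unfolding q_def by measurable
    have tq: "ennreal (t x powr p) \<le> q x" for x
    proof -
      have "t x powr p \<le> (\<bar>v x\<bar> / M) powr p"
        unfolding t_def using K M p by (intro powr_mono2 divide_left_mono) auto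
      then show ?thesis using M by (simp add: q_def powr_divide ennreal_leI flip: ennreal_mult)
    qed
    have "(\<integral>\<^sup>+x. q x \<partial>lebesgue) = ennreal (1 / M powr p) * Lp_power p UNIV v"
      unfolding q_def Lp_power_def lebesgue_on_UNIV_eq by (rule nn_integral_cmult) measurable
    also have "\<dots> \<le> ennreal (1 / M powr p) * ennreal (M powr p)" by (intro mult_left_mono Lp) auto
    also have "\<dots> = 1" using M by (simp flip: ennreal_mult)
    finally have int_q: "(\<integral>\<^sup>+x. q x \<partial>lebesgue) \<le> 1" .
    have pointwise: "\<psi> (ennreal \<bar>v x / (D * N)\<bar>) \<le> ennreal (1 / B) * (ennreal A + (q x + g x))" for x
    proof -
      have iB: "0 \<le> 1 / B" using B by simp
      have "\<bar>v x / (D * N)\<bar> = 1 / B * (c * t x)"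
        using B C K N c by (simp add: D_def t_def M_def abs_mult mult_ac)
      then have "ennreal \<bar>v x / (D * N)\<bar> = ennreal (1 / B) * ennreal (c * t x)"
        by (simp only: ennreal_mult'[OF iB])
      then have "\<psi> (ennreal \<bar>v x / (D * N)\<bar>) = \<psi> (ennreal (1 / B) * ennreal (c * t x))"
        by (rule arg_cong)
      also have "\<dots> \<le> ennreal (1 / B) * \<psi> (ennreal (c * t x))"
        using B by (intro young_scale[OF \<psi>]) auto
      also have "\<dots> \<le> ennreal (1 / B) * (ennreal A + (q x + g x))"
        using phi_g[of x] tq[of x]
        by (intro mult_left_mono order_trans[OF growth[OF t0]] add_mono) (auto simp: t_def)
      finally show ?thesis .
    qed
    have "orlicz_modular \<Omega> \<psi> (\<lambda>x. u x / (D * N))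
        \<le> (\<integral>\<^sup>+x. ennreal (1 / B) * (ennreal A + (q x + g x)) \<partial>lebesgue_on \<Omega>)"
      unfolding orlicz_modular_def
    proof (rule nn_integral_mono_AE)
      show "AE x in lebesgue_on \<Omega>.
          \<psi> (ennreal \<bar>u x / (D * N)\<bar>) \<le> ennreal (1 / B) * (ennreal A + (q x + g x))"
        using Eeq[OF u] by eventually_elim (metis pointwise v_def)
    qed
    also have "\<dots> = (\<integral>\<^sup>+x. ennreal (1 / B) * (ennreal A + (q x + g x)) * indicator \<Omega> x \<partial>lebesgue)"
      using \<Omega>m by (intro nn_integral_restrict_space) simp
    \<comment> \<open>The constant stays on \<open>\<Omega>\<close>; \<open>q\<close> and
      \<open>g\<close> are integrated over the whole space, where their bounds hold.\<close>
    also have "\<dots> \<le> (\<integral>\<^sup>+x. ennreal (1 / B) * (ennreal A * indicator \<Omega> x + (q x + g x)) \<partial>lebesgue)"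
      by (intro nn_integral_mono) (auto simp: indicator_def)
    also have "\<dots> = ennreal (1 / B) * (ennreal A * emeasure lebesgue \<Omega>
        + ((\<integral>\<^sup>+x. q x \<partial>lebesgue) + (\<integral>\<^sup>+x. g x \<partial>lebesgue)))"
      using \<Omega>m by (simp add: nn_integral_cmult nn_integral_add)
    also have "\<dots> \<le> ennreal (1 / B) * (ennreal A * emeasure lebesgue \<Omega> + (1 + 1))"
      by (intro mult_left_mono add_mono int_q int_g order_refl) auto
    also have "ennreal A * emeasure lebesgue \<Omega> + (1 + 1) = ennreal B"
    proof -
      obtain r where r: "ennreal A * emeasure lebesgue \<Omega> = ennreal r" "0 \<le> r"
        using A(2) by (cases "ennreal A * emeasure lebesgue \<Omega>") auto
      have "ennreal r + (1 + 1) = ennreal (r + 2)" using r(2) by (simp add: ennreal_plus)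
      then show ?thesis unfolding B_def r(1) using r(2) by (simp add: add.commute)
    qed
    also have "ennreal (1 / B) * ennreal B = 1" using B by (simp flip: ennreal_mult)
    finally show ?thesis .
  qed
  moreover have "0 < D" using B C K c by (simp add: D_def)
  ultimately show ?thesis by blast
qed

text \<open>The modular bound at some \<open>N\<close> above the norm makes \<open>D * N\<close>
  admissible in the Luxemburg infimum; letting \<open>N\<close> decrease to the norm gives the
  constant \<open>D\<close>.\<close>

lemma W_embeds_OrliczI:
  fixes A c :: real
  assumes "extension_domain p \<nu> \<Omega>" and "young \<psi>"
    and "0 \<le> A" "ennreal A * emeasure lebesgue \<Omega> < \<infinity>" and "0 < c"
    and "\<And>t. 0 \<le> t \<Longrightarrow>
       \<psi> (ennreal (c * t)) \<le> ennreal A + (ennreal (t powr p) + phi p \<nu> (ennreal t))"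
  shows "W_embeds_Orlicz p \<nu> \<Omega> \<psi>"
proof -
  obtain D where D: "0 < D" and bound: "\<And>u N. u \<in> W_space p \<nu> \<Omega> \<Longrightarrow> 0 < N \<Longrightarrow>
      W_norm p \<nu> \<Omega> u \<le> ennreal N \<Longrightarrow> orlicz_modular \<Omega> \<psi> (\<lambda>x. u x / (D * N)) \<le> 1"
    using extension_orlicz_modular_bound[OF assms] by blast
  have norm_finite: "\<exists>n\<ge>0. W_norm p \<nu> \<Omega> u = ennreal n" if "u \<in> W_space p \<nu> \<Omega>" for u
  proof -
    have "Lp_power p \<Omega> u + W_energy p \<nu> \<Omega> u < \<infinity>" using that by (simp add: W_space_def)
    then show ?thesis by (auto simp: W_norm_def epow_def intro!: exI[of _ "_ powr _"])
  qed
  have lux: "luxemburg_norm \<Omega> \<psi> u \<le> ennreal D * W_norm p \<nu> \<Omega> u" if u: "u \<in> W_space p \<nu> \<Omega>" for u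
  proof -
    obtain n where n: "0 \<le> n" "W_norm p \<nu> \<Omega> u = ennreal n" using norm_finite[OF u] by blast
    have "luxemburg_norm \<Omega> \<psi> u \<le> ennreal (D * n) + ennreal e" if e: "0 < e" for e
    proof -
      \<comment> \<open>The slack \<open>e / D\<close> keeps the bound positive when the norm is
        0.\<close>
      have "orlicz_modular \<Omega> \<psi> (\<lambda>x. u x / (D * (n + e / D))) \<le> 1"
        using n e D by (intro bound u) (auto intro!: ennreal_leI add_nonneg_pos)
      then have "luxemburg_norm \<Omega> \<psi> u \<le> ennreal (D * (n + e / D))"
        unfolding luxemburg_norm_def using n e D
        by (intro Inf_lower) (auto intro!: exI mult_pos_pos add_nonneg_pos)
      also have "\<dots> = ennreal (D * n) + ennreal e"
        using n e D by (simp add: distrib_left flip: ennreal_plus)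
      finally show ?thesis .
    qed
    then have "luxemburg_norm \<Omega> \<psi> u \<le> ennreal (D * n)" by (rule ennreal_le_epsilon)
    then show ?thesis using n D by (simp add: ennreal_mult)
  qed
  have "u \<in> orlicz_space \<Omega> \<psi>" if u: "u \<in> W_space p \<nu> \<Omega>" for u
  proof -
    obtain n where n: "0 \<le> n" "W_norm p \<nu> \<Omega> u = ennreal n" using norm_finite[OF u] by blast
    have "orlicz_modular \<Omega> \<psi> (\<lambda>x. u x / (D * (n + 1))) \<le> 1"
      using n by (intro bound u) (auto intro!: ennreal_leI)
    then have "orlicz_modular \<Omega> \<psi> (\<lambda>x. u x / (D * (n + 1))) < \<infinity>"
      by (rule order_le_less_trans) simp
    moreover have "0 < D * (n + 1)" using n D by simp
    ultimately show ?thesis using u unfolding orlicz_space_def W_space_def by blast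
  qed
  with lux show ?thesis unfolding W_embeds_Orlicz_def by blast
qed

end

theorem corollary3p16:
  fixes p \<theta> :: real
    and \<nu> :: "'a::euclidean_space \<Rightarrow> real"
    and \<Omega> :: "'a set"
  assumes "1 \<le> p"
    and "\<nu> \<in> borel_measurable (lebesgue_on (UNIV - {0}))"
    and "\<And>h. h \<noteq> 0 \<Longrightarrow> 0 \<le> \<nu> h"
    and "bij_betw (w_pot p \<nu>) {0..} {..<\<infinity>}"
    and "young (\<lambda>t. phi p \<nu> (epow t (1 / p)))"
    and "\<theta> > 0"
    and "\<And>s t. 0 \<le> s \<Longrightarrow> s \<le> t \<Longrightarrow> 0 < t \<Longrightarrow>
           phi p \<nu> (ennreal (\<theta> * s / t)) \<le> phi p \<nu> (ennreal s) / phi p \<nu> (ennreal t)"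
    and "extension_domain p \<nu> \<Omega>"
  shows "(\<forall>\<psi>. young \<psi> \<and>
             (\<exists>c>0. \<forall>t>0. \<psi> (ennreal (c * t)) \<le> max (ennreal (t powr p)) (phi p \<nu> (ennreal t)))
             \<longrightarrow> W_embeds_Orlicz p \<nu> \<Omega> \<psi>) \<and>
         (emeasure lebesgue \<Omega> < \<infinity> \<longrightarrow>
           (\<forall>\<psi>. young \<psi> \<and>
             (\<exists>c>0. \<forall>t\<ge>1. \<psi> (ennreal (c * t)) \<le> max (ennreal t) (phi p \<nu> (ennreal t)))
             \<longrightarrow> W_embeds_Orlicz p \<nu> \<Omega> \<psi>))"
proof -
  interpret sobolev_kernel p \<theta> \<nu> by unfold_locales (fact assms)+
  \<comment> \<open>Replacing the maximum by a sum allows the two contributions to be integrated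
    separately.\<close>
  have max_le: "max x y \<le> x + y" for x y :: ennreal by (simp add: max_def add_increasing add_increasing2)
  have "W_embeds_Orlicz p \<nu> \<Omega> \<psi>"
    if \<psi>: "young \<psi>" and c: "0 < c"
      and le: "\<And>t. 0 < t \<Longrightarrow> \<psi> (ennreal (c * t)) \<le> max (ennreal (t powr p)) (phi p \<nu> (ennreal t))"
    for \<psi> and c :: real
  proof (rule W_embeds_OrliczI[OF assms(8) \<psi> _ _ c, of 0])
    fix t :: real assume "0 \<le> t"
    then show "\<psi> (ennreal (c * t)) \<le> ennreal 0 + (ennreal (t powr p) + phi p \<nu> (ennreal t))"
      using \<psi> order_trans[OF le max_le, of t] by (cases "t = 0") (auto simp: young_def)
  qed auto
  moreover have "W_embeds_Orlicz p \<nu> \<Omega> \<psi>"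
    if fin: "emeasure lebesgue \<Omega> < \<infinity>" and \<psi>: "young \<psi>" and c: "0 < c"
      and le: "\<And>t. 1 \<le> t \<Longrightarrow> \<psi> (ennreal (c * t)) \<le> max (ennreal t) (phi p \<nu> (ennreal t))"
    for \<psi> and c :: real
  proof (rule W_embeds_OrliczI[OF assms(8) \<psi> _ _ c, of "1 + G 1"])
    \<comment> \<open>The constant \<open>1 + G 1\<close> bounds \<open>\<psi>(c)\<close>, hence
      \<open>\<psi>(c t)\<close> for all \<open>t < 1\<close>, using \<open>G 1 = \<phi>(1)\<close>.
      For \<open>t \<ge> 1\<close> the linear term is below \<open>t powr p\<close>.\<close>
    have G1: "0 \<le> G 1" by (simp add: G_def)
    show "0 \<le> 1 + G 1" using G1 by simp
    show "ennreal (1 + G 1) * emeasure lebesgue \<Omega> < \<infinity>"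
      using fin by (simp add: ennreal_mult_less_top)
    fix t :: real assume t: "0 \<le> t"
    show "\<psi> (ennreal (c * t)) \<le> ennreal (1 + G 1) + (ennreal (t powr p) + phi p \<nu> (ennreal t))"
    proof (cases "1 \<le> t")
      case True
      have "t \<le> t powr p" using powr_mono[of 1 p t] True assms(1) by simp
      then have "ennreal t + phi p \<nu> (ennreal t) \<le> ennreal (t powr p) + phi p \<nu> (ennreal t)"
        by (intro add_right_mono ennreal_leI)
      then show ?thesis using order_trans[OF le[OF True] max_le] by (meson add_increasing order_trans zero_le)
    next
      case False
      then have "\<psi> (ennreal (c * t)) \<le> \<psi> (ennreal (c * 1))"
        using t c by (intro young_mono[OF \<psi>]) auto
      also have "\<dots> \<le> ennreal 1 + ennreal (G 1)"
        using order_trans[OF le[of 1] max_le] phi_G[of 1] by simp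
      also have "\<dots> = ennreal (1 + G 1)" using G1 by (simp add: ennreal_plus)
      also have "\<dots> \<le> ennreal (1 + G 1) + (ennreal (t powr p) + phi p \<nu> (ennreal t))"
        by simp
      finally show ?thesis .
    qed
  qed
  ultimately show ?thesis by blast
qed

end
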